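(* Let $d\ge 2$, $1\le j\le d$, and let $\mathcal{S}_1,\dots,\mathcal{S}_n$ be $d$-tuples of polynomials in $\mathbb{R}[x_1,\dots,x_d]$ such that $$T_{[x_j]}(\mathcal{S}_1)\le T_{[x_j]}(\mathcal{S}_2)\le\cdots\le T_{[x_j]}(\mathcal{S}_n)$$ is a chain of sub-expansions of the expansion $T_{[x_j]}(\mathcal{S}_n)$. Then $$\big[T_{[x_j]}(\mathcal{S}_n):T_{[x_j]}(\mathcal{S}_1)\big]=\sum_{i=1}^{n-1}\big[T_{[x_j]}(\mathcal{S}_{i+1}):T_{[x_j]}(\mathcal{S}_i)\big]-(n-2).$$
   Context: Tuples are $d$-tuples $\mathcal{S}=(f_1,\dots,f_d)$ of polynomials in $\mathbb{R}[x_1,\dots,x_d]$, $d\ge2$. The expansion in the direction $x_j$ is the operator $T_{[x_j]}:=(\gamma^{-1}\circ\beta\circ\gamma\circ\nabla)_{[x_j]}$, where $\nabla_{[x_j]}(\mathcal{S})=(\partial f_1/\partial x_j,\dots,\partial f_d/\partial x_j)$, $\gamma$ turns a tuple into a column vector and $\beta$ multiplies by the $d\times d$ matrix with $0$ on the diagonal and $1$ elsewhere; so the $r$-th entry of $T_{[x_j]}(\mathcal{S})$ is $\sum_{t\ne r}\partial f_t/\partial x_j$. $T_{[x_j]}^k$ is the $k$-fold iterate. Sub-expansion: $T_{[x_j]}^k(\mathcal{S}_z)\le T_{[x_j]}^l(\mathcal{S}_t)$ means there exists some $m\ge 0$ with $T_{[x_j]}^k(\mathcal{S}_z)=T_{[x_j]}^{k+m}(\mathcal{S}_t)$.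 Index: $[T_{[x_j]}(\mathcal{S}_t):T_{[x_j]}(\mathcal{S}_z)]$ is the value of $r\in\mathbb{N}$ such that $T_{[x_j]}(\mathcal{S}_z)=T_{[x_j]}^r(\mathcal{S}_t)$ (and is $\infty$ if no such $r$ exists). *)

theory Defs
  imports "HOL-Analysis.Finite_Cartesian_Product" "HOL-Library.Poly_Mapping" "HOL-Library.Extended_Real"
begin

text \<open>The finite type \<open>'d\<close> indexes both the variables and the entries of a tuple, so
  \<open>d = CARD('d)\<close>. A polynomial maps each exponent vector \<open>'d \<Rightarrow>\<^sub>0 nat\<close> to its real coefficient,
  with finite support; multiplication is convolution.\<close>

type_synonym 'd polynomial = "('d \<Rightarrow>\<^sub>0 nat) \<Rightarrow>\<^sub>0 real"

type_synonym 'd tuple = "'d \<Rightarrow> 'd polynomial"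

text \<open>Termwise differentiation. Subtraction of exponents is truncated, which only affects monomials
  not containing the variable \<open>j\<close>; their coefficient is multiplied by 0.\<close>

definition partial_deriv :: "'d \<Rightarrow> 'd polynomial \<Rightarrow> 'd polynomial" where
  "partial_deriv j p =
     (\<Sum>m\<in>Poly_Mapping.keys p.
        Poly_Mapping.single (m - Poly_Mapping.single j 1)
          (real (Poly_Mapping.lookup m j) * Poly_Mapping.lookup p m))"

lemma lookup_partial_deriv:
  "Poly_Mapping.lookup (partial_deriv j p) m =
     real (Poly_Mapping.lookup m j + 1) * Poly_Mapping.lookup p (m + Poly_Mapping.single j 1)"
proof -
  let ?e = "Poly_Mapping.single j (1::nat)"
  let ?c = "\<lambda>k. real (Poly_Mapping.lookup k j) * Poly_Mapping.lookup p k"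
  have eq: "(?c k when k - ?e = m) = (?c k when k = m + ?e)" for k
  proof (cases "Poly_Mapping.lookup k j = 0")
    case False
    then have "k - ?e + ?e = k"
      by (intro poly_mapping_eqI) (auto simp: lookup_add lookup_minus lookup_single when_def)
    then have "k - ?e = m \<longleftrightarrow> k = m + ?e"
      by (metis add_diff_cancel_right')
    then show ?thesis by simp
  qed (auto simp: when_def)
  have "Poly_Mapping.lookup (partial_deriv j p) m
      = (\<Sum>k\<in>Poly_Mapping.keys p. ?c k when k = m + ?e)"
    by (simp only: partial_deriv_def lookup_sum lookup_single eq)
  also have "\<dots> = ?c (m + ?e)"
    by (auto simp: when_def sum.delta in_keys_iff)
  finally show ?thesis by (simp add: lookup_add)
qed

definition nabla :: "'d \<Rightarrow> 'd tuple \<Rightarrow> 'd tuple" where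
  "nabla j S = (\<lambda>r. partial_deriv j (S r))"

definition gamma :: "'d::finite tuple \<Rightarrow> 'd polynomial ^ 'd" where
  "gamma S = (\<chi> r. S r)"

definition beta_matrix :: "'d::finite polynomial ^ 'd ^ 'd" where
  "beta_matrix = (\<chi> r t. if r = t then 0 else 1)"

definition beta :: "'d::finite polynomial ^ 'd \<Rightarrow> 'd polynomial ^ 'd" where
  "beta v = beta_matrix *v v"

definition expansion :: "'d::finite \<Rightarrow> 'd tuple \<Rightarrow> 'd tuple" where
  "expansion j = inv gamma \<circ> beta \<circ> gamma \<circ> nabla j"

lemma bij_gamma: "bij gamma"
  by (rule bij_betw_byWitness[where f' = vec_nth]) (auto simp: gamma_def)

lemma expansion_apply: "expansion j S r = (\<Sum>t\<in>UNIV - {r}. partial_deriv j (S t))"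
proof -
  have inv: "inv gamma = vec_nth"
    by (rule inv_equality) (auto simp: gamma_def)
  have "expansion j S r = (\<Sum>t\<in>UNIV. if r = t then 0 else partial_deriv j (S t))"
    by (auto simp: expansion_def inv gamma_def beta_def beta_matrix_def nabla_def
        matrix_vector_mult_def intro!: sum.cong)
  also have "\<dots> = (\<Sum>t\<in>UNIV - {r}. partial_deriv j (S t))"
    by (rule sum.mono_neutral_cong_right) auto
  finally show ?thesis .
qed

text \<open>\<open>sub_expansion j k A l B\<close> is the relation between \<open>T\<^sup>k(A)\<close> and \<open>T\<^sup>l(B)\<close> in the direction
  \<open>j\<close>. The defining condition does not mention \<open>l\<close>.\<close>

definition sub_expansion ::
    "'d::finite \<Rightarrow> nat \<Rightarrow> 'd tuple \<Rightarrow> nat \<Rightarrow> 'd tuple \<Rightarrow> bool" where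
  "sub_expansion j k A l B \<longleftrightarrow> (\<exists>m. (expansion j ^^ k) A = (expansion j ^^ (k + m)) B)"

text \<open>\<open>expansion_index j B A\<close> is \<open>[T(B) : T(A)]\<close>. Since \<open>T\<close> lowers the degree in \<open>x\<^sub>j\<close>, the exponent
  \<open>r\<close> is unique unless \<open>T(A) = 0\<close>, where every large \<open>r\<close> qualifies; then the least positive one is
  taken. The infimum of the empty set is \<open>\<infinity>\<close>.\<close>

definition expansion_index :: "'d::finite \<Rightarrow> 'd tuple \<Rightarrow> 'd tuple \<Rightarrow> enat" where
  "expansion_index j B A =
     (INF r\<in>{r. 1 \<le> r \<and> expansion j A = (expansion j ^^ r) B}. enat r)"

end

theory Submission
  imports Defs
begin

text \<open>The index behaves like the index of a subgroup, except that it is additive: if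
  \<open>T(A) \<le> T(B) \<le> T(C)\<close>, then \<open>[T(C) : T(A)] = [T(C) : T(B)] + [T(B) : T(A)] - 1\<close>
  (\<open>expansion_index_compose\<close>), because \<open>T(A) = T\<^sup>p(B) = T\<^sup>p\<^sup>-\<^sup>1(T(B)) = T\<^sup>p\<^sup>-\<^sup>1(T\<^sup>q(C))\<close>. Along a chain of
  \<open>n \<ge> 2\<close> tuples this rule joins \<open>n - 1\<close> indices in \<open>n - 2\<close> steps, which accounts for the
  correction term; for \<open>n = 1\<close> the formula says that an expansion has index 1 in itself.

  The point that needs care is the minimality of the exponent \<open>p + q - 1\<close>. Each application of \<open>T\<close>
  lowers the degree in \<open>x\<^sub>j\<close>, so \<open>T\<close> is nilpotent on every single tuple and two different iterates
  of the same tuple agree only when both vanish (\<open>expansion_collision_zero\<close>). Hence a smaller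
  exponent can occur only if \<open>T(A) = 0\<close>, and in that case the minimality of \<open>p\<close> or that of \<open>q\<close>
  excludes it. The additive rule therefore holds also for vanishing expansions.\<close>

section \<open>Nilpotency of the expansion\<close>

lemma partial_deriv_zero: "partial_deriv j 0 = 0"
  by (simp add: partial_deriv_def)

lemma funpow_expansion_zero: "(expansion j ^^ k) (\<lambda>_. 0) = (\<lambda>_. 0)"
  by (induction k) (auto simp: expansion_apply partial_deriv_zero fun_eq_iff)

text \<open>The induction is on a strict bound \<open>N\<close> for the degrees in \<open>x\<^sub>j\<close>; the bound \<open>0\<close> leaves no
  monomial at all.\<close>

lemma funpow_expansion_eq_zero_if_degree_less:
  assumes "\<And>t m. N \<le> Poly_Mapping.lookup m j \<Longrightarrow> Poly_Mapping.lookup (S t) m = 0"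
  shows "(expansion j ^^ N) S = (\<lambda>_. 0)"
  using assms
proof (induction N arbitrary: S)
  case 0
  then show ?case by (auto simp: fun_eq_iff intro!: poly_mapping_eqI)
next
  case (Suc N)
  have "Poly_Mapping.lookup (expansion j S t) m = 0" if "N \<le> Poly_Mapping.lookup m j" for t m
    using that Suc.prems
    by (simp add: expansion_apply lookup_sum lookup_partial_deriv lookup_add)
  then have "(expansion j ^^ N) (expansion j S) = (\<lambda>_. 0)"
    by (rule Suc.IH)
  then show ?case by (simp add: funpow_Suc_right del: funpow.simps)
qed

lemma expansion_nilpotent: "\<exists>N. (expansion j ^^ N) S = (\<lambda>_. 0)"
proof -
  let ?D = "\<Union>t. (\<lambda>m. Poly_Mapping.lookup m j) ` Poly_Mapping.keys (S t)"
  have "finite ?D" by simp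
  then obtain N where N: "\<forall>k\<in>?D. k < N"
    using finite_nat_set_iff_bounded by blast
  have "Poly_Mapping.lookup (S t) m = 0" if "N \<le> Poly_Mapping.lookup m j" for t m
  proof (rule ccontr)
    assume "Poly_Mapping.lookup (S t) m \<noteq> 0"
    then have "Poly_Mapping.lookup m j \<in> ?D" by (force simp: in_keys_iff)
    with N that show False by (metis not_less)
  qed
  then show ?thesis
    using funpow_expansion_eq_zero_if_degree_less by blast
qed

lemma funpow_funpow: "(f ^^ a) ((f ^^ b) x) = (f ^^ (a + b)) x"
  by (simp add: funpow_add)

text \<open>If two iterates agree, the sequence of iterates is periodic from the first of them on; being
  eventually zero, it is zero from there on.\<close>

lemma expansion_collision_zero:
  assumes "(expansion j ^^ r) C = (expansion j ^^ s) C" and "r < s"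
  shows "(expansion j ^^ r) C = (\<lambda>_. 0)"
proof -
  let ?T = "expansion j"
  have period: "(?T ^^ (s - r)) ((?T ^^ r) C) = (?T ^^ r) C"
    unfolding funpow_funpow using assms(2) by (simp add: assms(1))
  have cycle: "(?T ^^ (k * (s - r))) ((?T ^^ r) C) = (?T ^^ r) C" for k
    by (induction k) (simp_all add: funpow_add period)
  obtain N where N: "(?T ^^ N) ((?T ^^ r) C) = (\<lambda>_. 0)"
    using expansion_nilpotent by blast
  have "N * 1 \<le> N * (s - r)"
    using assms(2) by (intro mult_le_mono2) simp
  then have "N * (s - r) - N + N = N * (s - r)"
    by (intro le_add_diff_inverse2) (simp only: mult_1_right)
  then have "(?T ^^ (N * (s - r))) ((?T ^^ r) C)
      = (?T ^^ (N * (s - r) - N)) ((?T ^^ N) ((?T ^^ r) C))"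
    by (simp only: funpow_funpow[of "N * (s - r) - N" ?T N])
  then show ?thesis
    by (simp add: cycle N funpow_expansion_zero)
qed

section \<open>Indices of sub-expansions\<close>

lemma expansion_index_eqI:
  assumes "1 \<le> r" and "expansion j A = (expansion j ^^ r) B"
    and "\<And>s. 1 \<le> s \<Longrightarrow> expansion j A = (expansion j ^^ s) B \<Longrightarrow> r \<le> s"
  shows "expansion_index j B A = enat r"
  unfolding expansion_index_def
  by (rule antisym) (use assms in \<open>auto intro!: INF_lower INF_greatest\<close>)

lemma expansion_index_attained:
  assumes "sub_expansion j 1 A 1 B"
  obtains r where "1 \<le> r" and "expansion j A = (expansion j ^^ r) B"
    and "\<And>s. 1 \<le> s \<Longrightarrow> expansion j A = (expansion j ^^ s) B \<Longrightarrow> r \<le> s"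
    and "expansion_index j B A = enat r"
proof -
  let ?P = "\<lambda>r. 1 \<le> r \<and> expansion j A = (expansion j ^^ r) B"
  from assms obtain m where "?P (1 + m)"
    by (auto simp: sub_expansion_def)
  then have "?P (LEAST r. ?P r)"
    by (rule LeastI)
  moreover have "(LEAST r. ?P r) \<le> s" if "?P s" for s
    using that by (rule Least_le)
  ultimately show thesis
    using that expansion_index_eqI by blast
qed

lemma expansion_index_self: "expansion_index j A A = 1"
  using expansion_index_eqI[of 1 j A A] by (simp add: one_enat_def)

text \<open>The chain relates \<open>T(B)\<close>, not \<open>B\<close>, to an iterate of \<open>C\<close>, so one of the \<open>p\<close> applications of
  \<open>T\<close> to \<open>B\<close> is absorbed in \<open>T(B) = T\<^sup>q(C)\<close>.\<close>

lemma expansion_eq_funpow_compose: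
  assumes "1 \<le> p" and "expansion j A = (expansion j ^^ p) B"
    and "expansion j B = (expansion j ^^ q) C"
  shows "expansion j A = (expansion j ^^ (p - 1 + q)) C"
proof -
  have "p = Suc (p - 1)"
    using assms(1) by simp
  then have "expansion j A = (expansion j ^^ (p - 1)) (expansion j B)"
    by (metis assms(2) funpow_Suc_right comp_apply)
  then show ?thesis
    by (simp only: assms(3) funpow_funpow)
qed

lemma sub_expansion_refl: "sub_expansion j k A k A"
  unfolding sub_expansion_def by (intro exI[of _ 0]) simp

lemma sub_expansion_trans:
  assumes "sub_expansion j 1 A 1 B" and "sub_expansion j 1 B 1 C"
  shows "sub_expansion j 1 A 1 C"
proof -
  obtain p q where "expansion j A = (expansion j ^^ (1 + p)) B"
    and "expansion j B = (expansion j ^^ (1 + q)) C"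
    using assms by (auto simp: sub_expansion_def)
  then have "expansion j A = (expansion j ^^ (1 + p - 1 + (1 + q))) C"
    by (rule expansion_eq_funpow_compose[rotated]) simp
  then have "(expansion j ^^ 1) A = (expansion j ^^ (1 + (p + q))) C"
    by simp
  then show ?thesis
    unfolding sub_expansion_def by blast
qed

text \<open>An exponent \<open>r\<close> smaller than \<open>p + q - 1\<close> forces \<open>T(A) = 0\<close>. If \<open>r \<ge> q\<close>, then \<open>T\<^sup>r(C)\<close> is an
  iterate of \<open>T(B)\<close> with an exponent too small for the minimality of \<open>p\<close>. If \<open>r < q\<close>, then already
  \<open>T(B) = T\<^sup>q(C)\<close> vanishes and equals \<open>T\<^sup>r(C)\<close>, against the minimality of \<open>q\<close>.\<close>

lemma expansion_index_compose:
  assumes "sub_expansion j 1 A 1 B" and "sub_expansion j 1 B 1 C"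
  shows "expansion_index j C A + 1 = expansion_index j C B + expansion_index j B A"
proof -
  let ?T = "expansion j"
  obtain p where p: "1 \<le> p" "?T A = (?T ^^ p) B"
    and p_least: "\<And>s. 1 \<le> s \<Longrightarrow> ?T A = (?T ^^ s) B \<Longrightarrow> p \<le> s"
    and index_p: "expansion_index j B A = enat p"
    using expansion_index_attained[OF assms(1)] by blast
  obtain q where q: "1 \<le> q" "?T B = (?T ^^ q) C"
    and q_least: "\<And>s. 1 \<le> s \<Longrightarrow> ?T B = (?T ^^ s) C \<Longrightarrow> q \<le> s"
    and index_q: "expansion_index j C B = enat q"
    using expansion_index_attained[OF assms(2)] by blast
  have eq: "?T A = (?T ^^ (p - 1 + q)) C"
    using p q by (intro expansion_eq_funpow_compose)
  have "expansion_index j C A = enat (p - 1 + q)"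
  proof (rule expansion_index_eqI)
    show "1 \<le> p - 1 + q" using q by simp
    show "?T A = (?T ^^ (p - 1 + q)) C" by (fact eq)
  next
    fix r assume r: "1 \<le> r" "?T A = (?T ^^ r) C"
    show "p - 1 + q \<le> r"
    proof (rule ccontr)
      assume "\<not> p - 1 + q \<le> r"
      then have less: "r < p - 1 + q" by simp
      then have zero: "(?T ^^ r) C = (\<lambda>_. 0)"
        using eq r by (intro expansion_collision_zero) auto
      show False
      proof (cases "q \<le> r")
        case True
        have "?T A = (?T ^^ (r - q)) ((?T ^^ q) C)"
          using r True by (simp add: funpow_funpow)
        also have "\<dots> = (?T ^^ Suc (r - q)) B"
          by (simp add: q(2)[symmetric] funpow_Suc_right del: funpow.simps)
        finally have "p \<le> Suc (r - q)"
          by (intro p_least) auto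
        then show False using less True by linarith
      next
        case False
        have "?T B = (?T ^^ (q - r)) ((?T ^^ r) C)"
          using q False by (simp add: funpow_funpow)
        also have "\<dots> = (?T ^^ r) C"
          by (simp add: zero funpow_expansion_zero)
        finally show False using q_least r False by blast
      qed
    qed
  qed
  then show ?thesis
    using p by (simp add: index_p index_q one_enat_def)
qed

section \<open>Chains of sub-expansions\<close>

text \<open>Adding \<open>n\<close> on the left and \<open>2\<close> on the right avoids subtraction, so that the induction takes
  place in the semiring of extended naturals.\<close>

lemma expansion_index_chain:
  assumes "1 \<le> n"
    and "\<And>i. 1 \<le> i \<Longrightarrow> i < n \<Longrightarrow> sub_expansion j 1 (S i) 1 (S (i + 1))"
  shows "sub_expansion j 1 (S 1) 1 (S n) \<and>
    expansion_index j (S n) (S 1) + enat n = (\<Sum>i=1..<n. expansion_index j (S (i + 1)) (S i)) + 2"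
  using assms
proof (induction n rule: nat_induct_at_least)
  case base
  show ?case
    by (simp add: sub_expansion_refl expansion_index_self one_enat_def numeral_eq_enat)
next
  case (Suc n)
  then have IH: "sub_expansion j 1 (S 1) 1 (S n)"
    "expansion_index j (S n) (S 1) + enat n
      = (\<Sum>i=1..<n. expansion_index j (S (i + 1)) (S i)) + 2"
    and step: "sub_expansion j 1 (S n) 1 (S (Suc n))"
    by simp_all
  have "expansion_index j (S (Suc n)) (S 1) + enat (Suc n)
      = (expansion_index j (S (Suc n)) (S 1) + 1) + enat n"
    by (simp add: add.assoc one_enat_def)
  also have "\<dots> = expansion_index j (S (Suc n)) (S n) + (expansion_index j (S n) (S 1) + enat n)"
    by (simp only: expansion_index_compose[OF IH(1) step] add.assoc)
  also have "\<dots> = (\<Sum>i=1..<Suc n. expansion_index j (S (i + 1)) (S i)) + 2"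
    using Suc.hyps by (simp only: IH(2)) (simp add: ac_simps)
  finally show ?case
    using sub_expansion_trans[OF IH(1) step] by blast
qed

lemma ereal_of_enat_sum: "ereal_of_enat (sum f A) = (\<Sum>i\<in>A. ereal_of_enat (f i))"
  by (induction A rule: infinite_finite_induct) (simp_all add: ereal_of_enat_add)

theorem theorem10p5:
  fixes j :: "'d::finite" and S :: "nat \<Rightarrow> 'd tuple" and n :: nat
  assumes "CARD('d) \<ge> 2"
    and "n \<ge> 1"
    and "\<And>i. 1 \<le> i \<Longrightarrow> i < n \<Longrightarrow> sub_expansion j 1 (S i) 1 (S (i + 1))"
  shows "ereal_of_enat (expansion_index j (S n) (S 1)) =
           (\<Sum>i=1..<n. ereal_of_enat (expansion_index j (S (i + 1)) (S i))) - ereal (real n - 2)"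
proof -
  let ?sum = "\<Sum>i=1..<n. expansion_index j (S (i + 1)) (S i)"
  have sub: "sub_expansion j 1 (S 1) 1 (S n)"
    and eq: "expansion_index j (S n) (S 1) + enat n = ?sum + 2"
    using expansion_index_chain[of n j S] assms(2,3) by blast+
  obtain r where r: "expansion_index j (S n) (S 1) = enat r"
    using expansion_index_attained[OF sub] by blast
  then obtain s where s: "?sum = enat s"
    using eq by (cases ?sum) auto
  have "real r = real s - (real n - 2)"
    using eq unfolding r s by (simp add: numeral_eq_enat)
  then have "ereal_of_enat (expansion_index j (S n) (S 1))
      = ereal_of_enat ?sum - ereal (real n - 2)"
    unfolding r s by simp
  then show ?thesis
    by (simp only: ereal_of_enat_sum)
qed

end
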